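(* Assume $q^{2d}\neq1$ for all integers $d\ge1$. Then for every totally ordered index set $I$, the subalgebra $H_I^{Inv}$ of invariant elements of $H_I$ is generated by the elements $(ij)$, $i,j\in I$.
   Context: Fix $q\in\mathbb C$ with $|q|=1$, $q\neq\pm1,\pm i$, and a square root $q^{1/2}$. For a totally ordered index set $I$, $H_I$ is the unital associative $\mathbb C$-algebra generated by $x_i,y_i$ ($i\in I$) with relations $x_iy_i=qy_ix_i$ and, for $i<j$: $x_jx_i=q^2x_ix_j$, $y_jy_i=q^2y_iy_j$, $x_jy_i=qy_ix_j+(q^2-1)x_iy_j$, $y_jx_i=qx_iy_j$. The algebra $U_q(gl(2,\mathbb R))$ is generated by $E,F,K^{\pm1},L^{\pm1}$ ($L^{\pm1}$ central, $KK^{-1}=K^{-1}K=LL^{-1}=L^{-1}L=1$, $KE=qEK$, $KF=q^{-1}FK$, $EF-FE=\frac{K^2-K^{-2}}{q-q^{-1}}$) and acts on $H_I$ by $L1=K1=1$, $E1=F1=0$, $Lx_i=q^{1/2}x_i$, $Ly_i=q^{1/2}y_i$, $Kx_i=q^{-1/2}x_i$, $Ky_i=q^{1/2}y_i$, $Ex_i=q^{1/2}y_i$, $Ey_i=0$, $Fx_i=0$, $Fy_i=q^{-1/2}x_i$, extended by $K(ab)=K(a)K(b)$, $L(ab)=L(a)L(b)$, $E(ab)=E(a)K(b)+K^{-1}(a)E(b)$, $F(ab)=F(a)K(b)+K^{-1}(a)F(b)$. An element $a\in H_I$ is an invariant element of degree $k$ if $Ea=Fa=0$, $Ka=a$ and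 $La=q^{k/2}a$; $H_I^{Inv}$ is the subalgebra spanned by all invariant elements. $(ij):=q^{-1/2}x_iy_j-q^{1/2}y_ix_j$. *)

theory Defs
  imports Complex_Main "HOL-Library.Poly_Mapping"
begin

datatype 'i gen = Xg 'i | Yg 'i

datatype 'g word = Word "'g list"

fun word_list :: "'g word \<Rightarrow> 'g list" where
  "word_list (Word w) = w"

instantiation word :: (type) monoid_add
begin
definition zero_word :: "'a word" where "zero_word = Word []"
definition plus_word :: "'a word \<Rightarrow> 'a word \<Rightarrow> 'a word" where
  "plus_word u v = Word (word_list u @ word_list v)"
instance
proof
  fix a b c :: "'a word"
  show "a + b + c = a + (b + c)" by (cases a; cases b; cases c) (simp add: plus_word_def)
  show "0 + a = a" by (cases a) (simp add: plus_word_def zero_word_def)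
  show "a + 0 = a" by (cases a) (simp add: plus_word_def zero_word_def)
qed
end

text \<open>The free associative unital C-algebra on the generators: finitely supported
  complex functions on words, with convolution product (a ring_1 by the library).\<close>
type_synonym 'i fa = "'i gen word \<Rightarrow>\<^sub>0 complex"

definition cst :: "complex \<Rightarrow> 'i fa" where
  "cst c = Poly_Mapping.single 0 c"

definition wrd :: "'i gen list \<Rightarrow> 'i fa" where
  "wrd w = Poly_Mapping.single (Word w) 1"

definition xg :: "'i \<Rightarrow> 'i fa" where "xg i = wrd [Xg i]"
definition yg :: "'i \<Rightarrow> 'i fa" where "yg i = wrd [Yg i]"

inductive_set rels :: "complex \<Rightarrow> ('i::linorder) fa set" for q :: complex where
  "xg i * yg i - cst q * (yg i * xg i) \<in> rels q"
| "i < j \<Longrightarrow> xg j * xg i - cst (q^2) * (xg i * xg j) \<in> rels q"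
| "i < j \<Longrightarrow> yg j * yg i - cst (q^2) * (yg i * yg j) \<in> rels q"
| "i < j \<Longrightarrow> xg j * yg i - cst q * (yg i * xg j) - cst (q^2 - 1) * (xg i * yg j) \<in> rels q"
| "i < j \<Longrightarrow> yg j * xg i - cst q * (xg i * yg j) \<in> rels q"

text \<open>Two-sided ideal of the free algebra generated by the relations; H_I = free algebra / Jdl q.\<close>
inductive_set Jdl :: "complex \<Rightarrow> ('i::linorder) fa set" for q :: complex where
  Jdl_rel: "r \<in> rels q \<Longrightarrow> r \<in> Jdl q"
| Jdl_zero: "0 \<in> Jdl q"
| Jdl_add: "a \<in> Jdl q \<Longrightarrow> b \<in> Jdl q \<Longrightarrow> a + b \<in> Jdl q"
| Jdl_mult: "a \<in> Jdl q \<Longrightarrow> u * a * v \<in> Jdl q"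

section \<open>The action of E, F, K, K^-1, L (parameter s = q^(1/2))\<close>

fun Kgen :: "complex \<Rightarrow> 'i gen \<Rightarrow> complex" where
  "Kgen s (Xg i) = inverse s"
| "Kgen s (Yg i) = s"

definition Kw :: "complex \<Rightarrow> 'i gen list \<Rightarrow> complex" where
  "Kw s w = (\<Prod>g\<leftarrow>w. Kgen s g)"

definition Kinvw :: "complex \<Rightarrow> 'i gen list \<Rightarrow> complex" where
  "Kinvw s w = (\<Prod>g\<leftarrow>w. inverse (Kgen s g))"

definition Lw :: "complex \<Rightarrow> 'i gen list \<Rightarrow> complex" where
  "Lw s w = s ^ length w"

fun Egen :: "complex \<Rightarrow> 'i gen \<Rightarrow> 'i fa" where
  "Egen s (Xg i) = cst s * yg i"
| "Egen s (Yg i) = 0"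

fun Fgen :: "complex \<Rightarrow> 'i gen \<Rightarrow> 'i fa" where
  "Fgen s (Xg i) = 0"
| "Fgen s (Yg i) = cst (inverse s) * xg i"

text \<open>E(ab) = E(a)K(b) + K^-1(a)E(b), applied letter by letter.\<close>
fun Ew :: "complex \<Rightarrow> 'i gen list \<Rightarrow> 'i fa" where
  "Ew s [] = 0"
| "Ew s (g # w) = cst (Kw s w) * (Egen s g * wrd w) + cst (Kinvw s [g]) * (wrd [g] * Ew s w)"

fun Fw :: "complex \<Rightarrow> 'i gen list \<Rightarrow> 'i fa" where
  "Fw s [] = 0"
| "Fw s (g # w) = cst (Kw s w) * (Fgen s g * wrd w) + cst (Kinvw s [g]) * (wrd [g] * Fw s w)"

definition linext :: "('i gen list \<Rightarrow> 'i fa) \<Rightarrow> 'i fa \<Rightarrow> 'i fa" where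
  "linext T p = (\<Sum>w\<in>Poly_Mapping.keys p. cst (Poly_Mapping.lookup p w) * T (word_list w))"

definition actE :: "complex \<Rightarrow> 'i fa \<Rightarrow> 'i fa" where
  "actE s = linext (Ew s)"
definition actF :: "complex \<Rightarrow> 'i fa \<Rightarrow> 'i fa" where
  "actF s = linext (Fw s)"
definition actK :: "complex \<Rightarrow> 'i fa \<Rightarrow> 'i fa" where
  "actK s = linext (\<lambda>w. cst (Kw s w) * wrd w)"
definition actL :: "complex \<Rightarrow> 'i fa \<Rightarrow> 'i fa" where
  "actL s = linext (\<lambda>w. cst (Lw s w) * wrd w)"

text \<open>a (representing its class in H_I) is an invariant element of degree k:
  Ea = Fa = 0, Ka = a, La = q^(k/2) a = s^k a, all in H_I, i.e. modulo the ideal.\<close>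
definition invariant_deg :: "complex \<Rightarrow> complex \<Rightarrow> int \<Rightarrow> ('i::linorder) fa \<Rightarrow> bool" where
  "invariant_deg q s k a \<longleftrightarrow>
     actE s a \<in> Jdl q \<and> actF s a \<in> Jdl q \<and> actK s a - a \<in> Jdl q \<and>
     actL s a - cst (s powi k) * a \<in> Jdl q"

definition invariants :: "complex \<Rightarrow> complex \<Rightarrow> ('i::linorder) fa set" where
  "invariants q s = {a. \<exists>k. invariant_deg q s k a}"

inductive_set subalg :: "'i fa set \<Rightarrow> 'i fa set" for S :: "'i fa set" where
  "a \<in> S \<Longrightarrow> a \<in> subalg S"
| "cst c \<in> subalg S"
| "a \<in> subalg S \<Longrightarrow> b \<in> subalg S \<Longrightarrow> a + b \<in> subalg S"
| "a \<in> subalg S \<Longrightarrow> b \<in> subalg S \<Longrightarrow> a * b \<in> subalg S"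

definition pij :: "complex \<Rightarrow> 'i \<Rightarrow> 'i \<Rightarrow> 'i fa" where
  "pij s i j = cst (inverse s) * (xg i * yg j) - cst s * (yg i * xg j)"

end

theory Submission
  imports Defs
begin

text \<open>
  Call an element of \<open>H\<close> polynomial if it lies in the subalgebra generated by the \<open>(ij)\<close>. Every
  generator can be moved past every \<open>(ij)\<close> at the cost of replacing \<open>(ij)\<close> by other such elements, and
  \<open>x\<^sub>i y\<^sub>j = q y\<^sub>i x\<^sub>j + q\<^bsup>1/2\<^esup> (ij)\<close>. Hence, modulo \<open>\<Sum> (ij) H\<close>, a nonempty word of weight zero is a
  multiple of \<open>v = y\<dots>yx\<dots>x\<close> with equally many \<open>x\<close> and \<open>y\<close>, and replacing the first \<open>x\<close> in \<open>v\<close> by \<open>y\<close> gives a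
  word whose image under \<open>F\<close> is a nonzero multiple of \<open>v\<close>. Since \<open>F\<close> commutes with multiplication by
  \<open>(ij)\<close>, induction on the length shows that every element of weight zero has the form \<open>b + F c\<close> with
  \<open>b\<close> polynomial and \<open>K c = q c\<close>. If this element is invariant, then \<open>E F c = 0\<close>, and the commutation
  relation of \<open>E\<close> and \<open>F\<close> together with the nilpotency of \<open>E\<close> forces \<open>c = 0\<close>. No basis of \<open>H\<close> is needed.
\<close>

section \<open>The free algebra and the action on it\<close>

lemma cst_mult_wrd: "cst c * wrd w = Poly_Mapping.single (Word w) c"
  by (simp add: cst_def wrd_def mult_single)

lemma wrd_mult: "wrd u * wrd v = wrd (u @ v)"
  by (simp add: wrd_def mult_single plus_word_def)

lemma wrd_Nil: "wrd [] = 1"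
  by (simp add: wrd_def zero_word_def[symmetric])

lemma wrd_Cons: "wrd (g # w) = wrd [g] * wrd w"
  by (simp add: wrd_mult)

text \<open>Updating a function at a key outside its support adds a scaled word, so linear
  statements need checking only there.\<close>

lemma fa_induct [case_names word add]:
  assumes word: "\<And>c w. P (cst c * wrd w)"
    and add: "\<And>a b. P a \<Longrightarrow> P b \<Longrightarrow> P (a + b)"
  shows "P (a :: 'i fa)"
proof (induction a rule: update_induct)
  case const
  show ?case using word[of 0] by (simp add: cst_def)
next
  case (update f k c)
  have "Poly_Mapping.update k c f = cst c * wrd (word_list k) + f"
    using update(1) by (cases k; intro poly_mapping_eqI)
      (auto simp: cst_mult_wrd lookup_add lookup_update lookup_single in_keys_iff when_def)
  then show ?case using word add update by simp
qed

lemma cst_0 [simp]: "cst 0 = 0" and cst_1 [simp]: "cst 1 = 1"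
  by (simp_all add: cst_def)

lemma cst_add: "cst (a + b) = cst a + cst b"
  by (simp add: cst_def single_add)

lemma cst_mult: "cst (a * b) = cst a * cst b"
  by (simp add: cst_def mult_single)

lemma cst_uminus: "cst (- a) = - cst a"
  by (simp add: cst_def single_uminus)

lemma cst_diff: "cst (a - b) = cst a - cst b"
  by (simp add: cst_def single_diff)

lemma mult_cst: "a * cst c = cst c * (a :: 'i fa)"
proof (induction a rule: fa_induct)
  case (word d w)
  show ?case by (cases "Word w") (simp add: cst_mult_wrd, simp add: cst_def mult_single mult.commute)
next
  case (add a b)
  then show ?case by (simp add: algebra_simps)
qed

lemma mult_cst_left: "a * (cst c * b) = cst c * (a * (b :: 'i fa))"
  by (metis mult.assoc mult_cst)

lemma cst_mult_left: "cst c * (cst d * a) = cst (c * d) * a"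
  by (simp add: cst_mult mult.assoc)

lemma linext_superset:
  assumes "finite A" "Poly_Mapping.keys p \<subseteq> A"
  shows "linext T p = (\<Sum>w\<in>A. cst (Poly_Mapping.lookup p w) * T (word_list w))"
  unfolding linext_def
  by (rule sum.mono_neutral_left) (use assms in \<open>auto simp: in_keys_iff\<close>)

lemma linext_add: "linext T (a + b) = linext T a + linext T b"
proof -
  let ?A = "Poly_Mapping.keys a \<union> Poly_Mapping.keys b"
  have "Poly_Mapping.keys (a + b) \<subseteq> ?A" by (rule Poly_Mapping.keys_add)
  then show ?thesis
    by (simp add: linext_superset[of ?A] lookup_add cst_add distrib_right sum.distrib)
qed

lemma linext_word: "linext T (cst c * wrd w) = cst c * T w"
  unfolding cst_mult_wrd
  by (subst linext_superset[of "{Word w}"]) auto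

lemma linext_cst_mult: "linext T (cst c * a) = cst c * linext T a"
proof (induction a rule: fa_induct)
  case (word d w)
  show ?case by (simp add: cst_mult_left linext_word)
next
  case (add a b)
  then show ?case by (simp add: distrib_left linext_add)
qed

lemma linext_wrd: "linext T (wrd w) = T w"
  using linext_word[of T 1 w] by simp

lemma linext_0: "linext T 0 = 0"
  by (simp add: linext_def)

lemma linext_uminus: "linext T (- a) = - linext T a"
  using linext_cst_mult[of T "-1" a] by (simp add: cst_uminus)

lemma linext_diff: "linext T (a - b) = linext T a - linext T b"
  using linext_add[of T a "- b"] by (simp add: linext_uminus)

lemmas linext_linear = linext_add linext_cst_mult linext_0 linext_uminus linext_diff

lemma linext_mult:
  assumes "\<And>u v. T (u @ v) = T u * T' v"
    and "\<And>w. T' w = T w"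
  shows "linext T (a * b) = linext T a * linext T b"
proof (induction a rule: fa_induct)
  case (word c u)
  show ?case
  proof (induction b rule: fa_induct)
    case (word d v)
    have "cst c * wrd u * (cst d * wrd v) = cst (c * d) * wrd (u @ v)"
      by (simp add: mult.assoc mult_cst_left[of "wrd u"] cst_mult_left wrd_mult)
    then show ?case
      by (simp add: linext_word assms mult.assoc mult_cst_left[of "T u"] cst_mult_left)
  qed (simp add: distrib_left linext_add)
qed (simp add: distrib_right linext_add)

text \<open>An abstract skew derivation; it serves E and F at once, with \<open>A\<close> and
  \<open>B\<close> the actions of K and its inverse on words.\<close>

lemma linext_twisted_mult:
  assumes "\<And>u v. T (u @ v) = T u * A v + B u * T v"
  shows "linext T (a * b) = linext T a * linext A b + linext B a * linext T b"
proof (induction a rule: fa_induct)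
  case (word c u)
  show ?case
  proof (induction b rule: fa_induct)
    case (word d v)
    have "cst c * wrd u * (cst d * wrd v) = cst (c * d) * wrd (u @ v)"
      by (simp add: mult.assoc mult_cst_left[of "wrd u"] cst_mult_left wrd_mult)
    then show ?case
      by (simp add: linext_word assms mult.assoc mult_cst_left[of "T u"] mult_cst_left[of "B u"]
          cst_mult_left distrib_left)
  qed (simp add: distrib_left linext_add)
qed (simp add: distrib_right linext_add)

section \<open>The inverse of K and the twisted Leibniz rules\<close>

text \<open>\<open>Kinvw\<close> gives the inverse of K on words only; its linear extension is
  needed to state the Leibniz rules for arbitrary elements.\<close>

definition actKinv :: "complex \<Rightarrow> 'i fa \<Rightarrow> 'i fa" where
  "actKinv s = linext (\<lambda>w. cst (Kinvw s w) * wrd w)"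

lemma Kw_Nil [simp]: "Kw s [] = 1" and Kw_Cons [simp]: "Kw s (g # w) = Kgen s g * Kw s w"
  and Kw_append [simp]: "Kw s (u @ v) = Kw s u * Kw s v"
  by (simp_all add: Kw_def)

lemma Kinvw_Nil [simp]: "Kinvw s [] = 1"
  and Kinvw_Cons [simp]: "Kinvw s (g # w) = inverse (Kgen s g) * Kinvw s w"
  and Kinvw_append [simp]: "Kinvw s (u @ v) = Kinvw s u * Kinvw s v"
  by (simp_all add: Kinvw_def)

lemma Kinvw_eq: "Kinvw s w = inverse (Kw s w)"
  by (induction w) simp_all

lemma diag_mult:
  assumes "\<And>u v. f (u @ v) = f u * f v"
  shows "linext (\<lambda>w. cst (f w) * wrd w) (a * b)
    = linext (\<lambda>w. cst (f w) * wrd w) a * linext (\<lambda>w. cst (f w) * wrd w) b"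
  by (rule linext_mult)
    (simp_all add: assms mult.assoc mult_cst_left[of "wrd w" for w] cst_mult_left wrd_mult)

lemma actK_mult: "actK s (a * b) = actK s a * actK s b"
  unfolding actK_def by (rule diag_mult) simp

lemma actKinv_mult: "actKinv s (a * b) = actKinv s a * actKinv s b"
  unfolding actKinv_def by (rule diag_mult) simp

lemma actL_mult: "actL s (a * b) = actL s a * actL s b"
  unfolding actL_def by (rule diag_mult) (simp add: Lw_def power_add)

text \<open>The action splits off one letter at a time; since K and its inverse are multiplicative,
  induction on \<open>u\<close> splits off a whole word.\<close>

lemma Ew_append:
  "Ew s (u @ v) = Ew s u * (cst (Kw s v) * wrd v) + (cst (Kinvw s u) * wrd u) * Ew s v"
proof (induction u)
  case (Cons g u)
  show ?case
    by (simp add: Cons wrd_Cons[of g u] wrd_Cons[of g "u @ v"] wrd_mult[symmetric] distrib_left distrib_right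
        mult.assoc mult_cst_left[of "wrd w" for w] mult_cst_left[of "Egen s g"]
        cst_mult_left mult.commute[of "Kw s v"])
qed (simp add: wrd_Nil)

lemma Fw_append:
  "Fw s (u @ v) = Fw s u * (cst (Kw s v) * wrd v) + (cst (Kinvw s u) * wrd u) * Fw s v"
proof (induction u)
  case (Cons g u)
  show ?case
    by (simp add: Cons wrd_Cons[of g u] wrd_Cons[of g "u @ v"] wrd_mult[symmetric] distrib_left distrib_right
        mult.assoc mult_cst_left[of "wrd w" for w] mult_cst_left[of "Fgen s g"]
        cst_mult_left mult.commute[of "Kw s v"])
qed (simp add: wrd_Nil)

lemma actE_mult: "actE s (a * b) = actE s a * actK s b + actKinv s a * actE s b"
  unfolding actE_def actK_def actKinv_def by (rule linext_twisted_mult) (rule Ew_append)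

lemma actF_mult: "actF s (a * b) = actF s a * actK s b + actKinv s a * actF s b"
  unfolding actF_def actK_def actKinv_def by (rule linext_twisted_mult) (rule Fw_append)

lemmas act_linear =
  linext_linear[of "Ew s" for s, folded actE_def]
  linext_linear[of "Fw s" for s, folded actF_def]
  linext_linear[of "\<lambda>w. cst (Kw s w) * wrd w" for s, folded actK_def]
  linext_linear[of "\<lambda>w. cst (Kinvw s w) * wrd w" for s, folded actKinv_def]
  linext_linear[of "\<lambda>w. cst (Lw s w) * wrd w" for s, folded actL_def]

lemmas act_wrd =
  linext_wrd[of "Ew s" for s, folded actE_def]
  linext_wrd[of "Fw s" for s, folded actF_def]
  linext_wrd[of "\<lambda>w. cst (Kw s w) * wrd w" for s, folded actK_def]
  linext_wrd[of "\<lambda>w. cst (Kinvw s w) * wrd w" for s, folded actKinv_def]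
  linext_wrd[of "\<lambda>w. cst (Lw s w) * wrd w" for s, folded actL_def]

lemmas act_simps = act_linear act_wrd

lemmas act_mult = actE_mult actF_mult actK_mult actKinv_mult actL_mult

lemma act_1 [simp]: "actE s 1 = 0" "actF s 1 = 0" "actK s 1 = 1" "actKinv s 1 = 1" "actL s 1 = 1"
  using wrd_mult[of "[]" "[]"]
  by (simp_all add: wrd_Nil[symmetric] act_simps Lw_def)

lemma act_cst [simp]:
  "actE s (cst c) = 0" "actF s (cst c) = 0" "actK s (cst c) = cst c"
  "actKinv s (cst c) = cst c" "actL s (cst c) = cst c"
  \<comment> \<open>The indices select the rule for scalar multiples of each of the five
    operators.\<close>
  using act_linear(2,7,12,17,22)[of _ c 1] by simp_all

lemma act_gen [simp]:
  "actE s (xg i) = cst s * yg i" "actE s (yg i) = 0"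
  "actF s (xg i) = 0" "actF s (yg i) = cst (inverse s) * xg i"
  "actK s (xg i) = cst (inverse s) * xg i" "actK s (yg i) = cst s * yg i"
  "actKinv s (xg i) = cst s * xg i" "actKinv s (yg i) = cst (inverse s) * yg i"
  "actL s (xg i) = cst s * xg i" "actL s (yg i) = cst s * yg i"
  unfolding xg_def yg_def
  by (simp_all add: act_simps wrd_Nil xg_def yg_def Lw_def)

lemma wrd_gen: "wrd (Xg i # w) = xg i * wrd w" "wrd (Yg i # w) = yg i * wrd w"
  by (simp_all add: xg_def yg_def wrd_mult)

section \<open>The defining ideal\<close>

lemma Jdl_lmult: "a \<in> Jdl q \<Longrightarrow> u * a \<in> Jdl q"
  using Jdl_mult[of a q u 1] by simp

lemma Jdl_rmult: "a \<in> Jdl q \<Longrightarrow> a * v \<in> Jdl q"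
  using Jdl_mult[of a q 1 v] by simp

lemma Jdl_uminus: "a \<in> Jdl q \<Longrightarrow> - a \<in> Jdl q"
  using Jdl_lmult[of a q "- 1"] by simp

lemma Jdl_diff: "a \<in> Jdl q \<Longrightarrow> b \<in> Jdl q \<Longrightarrow> a - b \<in> Jdl q"
  using Jdl_add[of a q "- b"] Jdl_uminus[of b q] by simp

lemmas Jdl_intros = Jdl_zero Jdl_add Jdl_diff Jdl_uminus Jdl_lmult Jdl_rmult

text \<open>By \<open>generic\<close>, q^2 is not a root of unity, which makes the q-integers
  occurring as scalars invertible.\<close>

locale quantum_plane =
  fixes q s :: complex
  assumes s_sq: "s ^ 2 = q"
    and s_nz: "s \<noteq> 0"
    and generic: "d \<ge> 1 \<Longrightarrow> q ^ (2 * d) \<noteq> 1"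
begin

lemma q_nz: "q \<noteq> 0"
  using s_sq s_nz by auto

lemma s_inverse: "s * inverse s = 1" "inverse s * s = 1"
  "s * (inverse s * z) = z" "inverse s * (s * z) = z"
  using s_nz by simp_all

lemma cst_s [simp]:
  "cst s * cst (inverse s) = 1" "cst (inverse s) * cst s = 1"
  "cst s * (cst (inverse s) * a) = a" "cst (inverse s) * (cst s * a) = a"
  using s_nz by (simp_all add: cst_mult[symmetric] mult.assoc[symmetric])

lemma cst_q: "cst q = cst s * cst s" "cst (q ^ 2) = cst s * (cst s * (cst s * cst s))"
  "cst (q ^ 2 - 1) = cst s * (cst s * (cst s * cst s)) - 1"
  by (simp_all add: s_sq[symmetric] power2_eq_square cst_mult cst_diff mult.assoc)

text \<open>Scalars are expressed through \<^term>\<open>cst s\<close> and \<^term>\<open>cst (inverse s)\<close>, so that moving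
  them to the left gives normal forms without any arithmetic in the coefficients.\<close>
lemmas gen_cst [simp] =
  mult_cst[of "xg i" s for i] mult_cst_left[of "xg i" s for i]
  mult_cst[of "yg i" s for i] mult_cst_left[of "yg i" s for i]
  mult_cst[of "xg i" "inverse s" for i] mult_cst_left[of "xg i" "inverse s" for i]
  mult_cst[of "yg i" "inverse s" for i] mult_cst_left[of "yg i" "inverse s" for i]

text \<open>With explicit error terms in the ideal, congruences become equations usable as rewrite rules.\<close>
definition rd :: "'i \<Rightarrow> 'i fa" where
  "rd i = xg i * yg i - cst s * (cst s * (yg i * xg i))"

definition rxx :: "'i \<Rightarrow> 'i \<Rightarrow> 'i fa" where
  "rxx i j = xg j * xg i - cst s * (cst s * (cst s * (cst s * (xg i * xg j))))"

definition ryy :: "'i \<Rightarrow> 'i \<Rightarrow> 'i fa" where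
  "ryy i j = yg j * yg i - cst s * (cst s * (cst s * (cst s * (yg i * yg j))))"

definition rxy :: "'i \<Rightarrow> 'i \<Rightarrow> 'i fa" where
  "rxy i j = xg j * yg i - cst s * (cst s * (yg i * xg j))
    - cst s * (cst s * (cst s * (cst s * (xg i * yg j)))) + xg i * yg j"

definition ryx :: "'i \<Rightarrow> 'i \<Rightarrow> 'i fa" where
  "ryx i j = yg j * xg i - cst s * (cst s * (xg i * yg j))"

lemma r_Jdl: "rd i \<in> Jdl q"
  "i < j \<Longrightarrow> rxx i j \<in> Jdl q" "i < j \<Longrightarrow> ryy i j \<in> Jdl q"
  "i < j \<Longrightarrow> rxy i j \<in> Jdl q" "i < j \<Longrightarrow> ryx i j \<in> Jdl q"
  using rels.intros(1)[of i q, THEN Jdl_rel] rels.intros(2-)[of i j q, THEN Jdl_rel]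
  by (simp_all add: rd_def rxx_def ryy_def rxy_def ryx_def cst_q algebra_simps)

lemma same_rewrite:
  "xg i * yg i = cst s * (cst s * (yg i * xg i)) + rd i"
  "xg i * (yg i * z) = cst s * (cst s * (yg i * (xg i * z))) + rd i * z"
  by (simp_all add: rd_def algebra_simps)

text \<open>These hold for all i and j, the error terms being the differences of both sides;
  \<open>i < j\<close> enters only through \<open>r_Jdl\<close>. The versions with \<open>z\<close>
  apply inside right-nested products.\<close>

lemma sort_rewrite:
  "xg j * xg i = cst s * (cst s * (cst s * (cst s * (xg i * xg j)))) + rxx i j"
  "yg j * yg i = cst s * (cst s * (cst s * (cst s * (yg i * yg j)))) + ryy i j"
  "xg j * yg i = cst s * (cst s * (yg i * xg j))
      + cst s * (cst s * (cst s * (cst s * (xg i * yg j)))) - xg i * yg j + rxy i j"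
  "yg j * xg i = cst s * (cst s * (xg i * yg j)) + ryx i j"
  "xg j * (xg i * z) = cst s * (cst s * (cst s * (cst s * (xg i * (xg j * z))))) + rxx i j * z"
  "yg j * (yg i * z) = cst s * (cst s * (cst s * (cst s * (yg i * (yg j * z))))) + ryy i j * z"
  "xg j * (yg i * z) = cst s * (cst s * (yg i * (xg j * z)))
      + cst s * (cst s * (cst s * (cst s * (xg i * (yg j * z))))) - xg i * (yg j * z) + rxy i j * z"
  "yg j * (xg i * z) = cst s * (cst s * (xg i * (yg j * z))) + ryx i j * z"
  by (simp_all add: rxx_def ryy_def rxy_def ryx_def algebra_simps)

text \<open>E and F send a relation to 0 or to a combination of relations, visible after sorting the
  letters. All terms of a relation have the same weight, so K and its inverse scale it.\<close>

lemma rels_act: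
  assumes "r \<in> rels q"
  shows "actE s r \<in> Jdl q" "actF s r \<in> Jdl q" "actK s r \<in> Jdl q" "actKinv s r \<in> Jdl q"
proof -
  have "actE s r \<in> Jdl q \<and> actF s r \<in> Jdl q"
    using assms
  proof cases
    case (1 i)
    show ?thesis
      by (simp add: 1 act_mult act_simps cst_q algebra_simps Jdl_zero)
  next
    case (2 i j)
    from \<open>i < j\<close> show ?thesis
      by (simp add: 2(1) act_mult act_simps cst_q)
        (simp add: algebra_simps sort_rewrite[of j i] r_Jdl Jdl_intros)
  next
    case (3 i j)
    from \<open>i < j\<close> show ?thesis
      by (simp add: 3(1) act_mult act_simps cst_q)
        (simp add: algebra_simps sort_rewrite[of j i] r_Jdl Jdl_intros)
  next
    case (4 i j)
    from \<open>i < j\<close> show ?thesis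
      by (simp add: 4(1) act_mult act_simps cst_q)
        (simp add: algebra_simps sort_rewrite[of j i] r_Jdl Jdl_intros)
  next
    case (5 i j)
    from \<open>i < j\<close> show ?thesis
      by (simp add: 5(1) act_mult act_simps cst_q)
        (simp add: algebra_simps sort_rewrite[of j i] r_Jdl Jdl_intros)
  qed
  then show "actE s r \<in> Jdl q" "actF s r \<in> Jdl q" by auto
  have "\<exists>c d. actK s r = cst c * r \<and> actKinv s r = cst d * r"
    using assms
  proof cases
    case (1 i)
    show ?thesis
      by (intro exI[of _ 1]) (simp add: 1 act_mult act_simps cst_q algebra_simps)
  next
    case (2 i j)
    show ?thesis
      by (intro exI[of _ "inverse s * inverse s"] exI[of _ "s * s"])
        (simp add: 2(1) act_mult act_simps cst_q cst_mult algebra_simps)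
  next
    case (3 i j)
    show ?thesis
      by (intro exI[of _ "s * s"] exI[of _ "inverse s * inverse s"])
        (simp add: 3(1) act_mult act_simps cst_q cst_mult algebra_simps)
  next
    case (4 i j)
    show ?thesis
      by (intro exI[of _ 1]) (simp add: 4(1) act_mult act_simps cst_q algebra_simps)
  next
    case (5 i j)
    show ?thesis
      by (intro exI[of _ 1]) (simp add: 5(1) act_mult act_simps cst_q algebra_simps)
  qed
  then show "actK s r \<in> Jdl q" "actKinv s r \<in> Jdl q"
    using Jdl_rel[OF assms] by (auto intro: Jdl_lmult)
qed

section \<open>Moving generators past the elements $(ij)$\<close>

abbreviation cong :: "('i :: linorder) fa \<Rightarrow> 'i fa \<Rightarrow> bool" (infix \<open>\<approx>\<close> 50)
  where "a \<approx> b \<equiv> a - b \<in> Jdl q"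

text \<open>Here (ii) is \<open>cst (inverse s)\<close> times the relation between x_i and
  y_i.\<close>

lemma pij_same: "pij s i i \<in> Jdl q"
  by (simp add: pij_def algebra_simps r_Jdl Jdl_intros same_rewrite)

lemma pij_swap: assumes "i < j" shows "pij s j i \<approx> - pij s i j"
  using assms by (simp add: pij_def algebra_simps r_Jdl Jdl_intros sort_rewrite[of j i])

text \<open>One scalar serves both kinds of letter: E annihilates (ij) and K fixes it, so E carries
  the relation for x_k to the one for y_k. The same holds for the other positions of k
  below.\<close>

lemma pij_below:
  assumes "h = Xg \<or> h = Yg" "k < i" "i < j"
  shows "wrd [h k] * pij s i j \<approx> cst (inverse s ^ 6) * (pij s i j * wrd [h k])"
  using assms by (elim disjE) (simp_all add: pij_def algebra_simps r_Jdl Jdl_intros numeral_eq_Suc cst_mult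
    xg_def[symmetric] yg_def[symmetric]
    sort_rewrite[of i k] sort_rewrite[of j k])

lemma pij_above:
  assumes "h = Xg \<or> h = Yg" "j < k" "i < j"
  shows "wrd [h k] * pij s i j \<approx> cst (s ^ 6) * (pij s i j * wrd [h k])"
  using assms by (elim disjE) (simp_all add: pij_def algebra_simps r_Jdl Jdl_intros numeral_eq_Suc cst_mult
    xg_def[symmetric] yg_def[symmetric]
    sort_rewrite[of k j] sort_rewrite[of k i])

lemma pij_left:
  assumes "h = Xg \<or> h = Yg" "i < j"
  shows "wrd [h i] * pij s i j \<approx> cst (inverse s ^ 2) * (pij s i j * wrd [h i])"
  using assms by (elim disjE) (simp_all add: pij_def algebra_simps r_Jdl Jdl_intros numeral_eq_Suc cst_mult
    xg_def[symmetric] yg_def[symmetric]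
    sort_rewrite[of j i] same_rewrite[of i])

lemma pij_right:
  assumes "h = Xg \<or> h = Yg" "i < j"
  shows "wrd [h j] * pij s i j \<approx> cst (s ^ 2) * (pij s i j * wrd [h j])"
  using assms by (elim disjE) (simp_all add: pij_def algebra_simps r_Jdl Jdl_intros numeral_eq_Suc cst_mult
    xg_def[symmetric] yg_def[symmetric]
    sort_rewrite[of j i] same_rewrite[of j])

text \<open>The only position where the indices mix: a q-analogue of the three-term relation x_k
  (ij) = (ik) x_j + (kj) x_i for 2 x 2 minors.\<close>

lemma pij_between:
  assumes "h = Xg \<or> h = Yg" "i < k" "k < j"
  shows "wrd [h k] * pij s i j
    \<approx> cst (s ^ 2) * (pij s i k * wrd [h j]) + cst (inverse s ^ 2) * (pij s k j * wrd [h i])"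
  using assms by (elim disjE) (simp_all add: pij_def algebra_simps r_Jdl Jdl_intros numeral_eq_Suc cst_mult
    xg_def[symmetric] yg_def[symmetric]
    sort_rewrite[of k i] sort_rewrite[of j k] sort_rewrite[of j i])

section \<open>Compatibility of the action with the ideal and with the elements (ij)\<close>

text \<open>The Leibniz rules pass from the relations to the ideal, so the operators descend to the
  quotient H.\<close>

lemma act_Jdl:
  assumes "a \<in> Jdl q"
  shows "actE s a \<in> Jdl q" "actF s a \<in> Jdl q" "actK s a \<in> Jdl q" "actKinv s a \<in> Jdl q"
proof -
  have "actE s a \<in> Jdl q \<and> actF s a \<in> Jdl q \<and> actK s a \<in> Jdl q \<and> actKinv s a \<in> Jdl q"
    using assms
    by induction (simp_all add: rels_act act_simps act_mult Jdl_intros Jdl_mult)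
  then show "actE s a \<in> Jdl q" "actF s a \<in> Jdl q" "actK s a \<in> Jdl q" "actKinv s a \<in> Jdl q"
    by auto
qed

text \<open>The Leibniz terms cancel already in the free algebra, so F and K commute with left
  multiplication by (ij) exactly, not just modulo the ideal.\<close>

lemma act_pij [simp]:
  "actE s (pij s i j) = 0" "actF s (pij s i j) = 0"
  "actK s (pij s i j) = pij s i j" "actKinv s (pij s i j) = pij s i j"
  "actL s (pij s i j) = cst q * pij s i j"
  by (simp_all add: pij_def act_simps act_mult cst_q algebra_simps)

lemma actF_pij_mult: "actF s (pij s i j * a) = pij s i j * actF s a"
  and actK_pij_mult: "actK s (pij s i j * a) = pij s i j * actK s a"
  by (simp_all add: act_mult)

section \<open>Reduction of words modulo the elements $(ij)$\<close>

text \<open>Modulo the ideal, this is the part of \<Sum> (ij) H of length \<open>n\<close> and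
  K-eigenvalue \<kappa>. Since K fixes (ij), the remaining word has the same eigenvalue, as an
  induction on length within one weight requires.\<close>

inductive_set red :: "nat \<Rightarrow> complex \<Rightarrow> 'i::linorder fa set" for n :: nat and \<kappa> :: complex where
  red_Jdl: "a \<in> Jdl q \<Longrightarrow> a \<in> red n \<kappa>"
| red_pij: "length w + 2 = n \<Longrightarrow> Kw s w = \<kappa> \<Longrightarrow> pij s i j * wrd w \<in> red n \<kappa>"
| red_add: "a \<in> red n \<kappa> \<Longrightarrow> b \<in> red n \<kappa> \<Longrightarrow> a + b \<in> red n \<kappa>"
| red_cst: "a \<in> red n \<kappa> \<Longrightarrow> cst c * a \<in> red n \<kappa>"

lemma red_0: "0 \<in> red n \<kappa>"
  by (intro red_Jdl Jdl_zero)

lemma red_uminus: "a \<in> red n \<kappa> \<Longrightarrow> - a \<in> red n \<kappa>"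
  using red_cst[of a n \<kappa> "- 1"] by (simp add: cst_uminus)

lemma gen_pij_red:
  assumes "h = Xg \<or> h = Yg"
  shows "wrd [h k] * (pij s i j * wrd w) \<in> red (Suc (length w + 2)) (Kgen s (h k) * Kw s w)"
proof -
  have K: "Kgen s (h k') = Kgen s (h k)" for k'
    using assms by auto
  \<comment> \<open>Two terms are needed for an index strictly between i and j; elsewhere c2 = 0 and
    the indices of the second term are dummies.\<close>
  have step: "wrd [h k] * (pij s i j * wrd w) \<in> red (Suc (length w + 2)) (Kgen s (h k) * Kw s w)"
    if "wrd [h k] * pij s i j \<approx>
      cst c1 * (pij s i1 j1 * wrd [h k1]) + cst c2 * (pij s i2 j2 * wrd [h k2])"
    for i j i1 j1 k1 c1 i2 j2 k2 c2
  proof -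
    have "wrd [h k] * (pij s i j * wrd w) =
      (wrd [h k] * pij s i j
        - (cst c1 * (pij s i1 j1 * wrd [h k1]) + cst c2 * (pij s i2 j2 * wrd [h k2]))) * wrd w
      + (cst c1 * (pij s i1 j1 * wrd (h k1 # w)) + cst c2 * (pij s i2 j2 * wrd (h k2 # w)))"
      by (simp add: algebra_simps wrd_mult)
    also have "\<dots> \<in> red (Suc (length w + 2)) (Kgen s (h k) * Kw s w)"
      using that by (intro red_add red_cst red_pij red_Jdl Jdl_rmult) (simp_all add: K[of k1] K[of k2])
    finally show ?thesis .
  qed
  have less: "wrd [h k] * (pij s i j * wrd w) \<in> red (Suc (length w + 2)) (Kgen s (h k) * Kw s w)"
    if "i < j" for i j
  proof -
    consider "k < i" | "k = i" | "i < k" "k < j" | "k = j" | "j < k"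
      by fastforce
    then show ?thesis
    proof cases
      case 1
      then show ?thesis using pij_below[OF assms, of k i j] that
        by (intro step[of _ _ "inverse s ^ 6" i j k 0 i j k]) simp
    next
      case 2
      then show ?thesis using pij_left[OF assms, of i j] that
        by (intro step[of _ _ "inverse s ^ 2" i j k 0 i j k]) simp
    next
      case 3
      then show ?thesis using pij_between[OF assms, of i k j]
        by (intro step)
    next
      case 4
      then show ?thesis using pij_right[OF assms, of i j] that
        by (intro step[of _ _ "s ^ 2" i j k 0 i j k]) simp
    next
      case 5
      then show ?thesis using pij_above[OF assms, of j k i] that
        by (intro step[of _ _ "s ^ 6" i j k 0 i j k]) simp
    qed
  qed
  consider "i < j" | "i = j" | "j < i" by fastforce
  then show ?thesis
  proof cases
    case 1
    then show ?thesis by (rule less)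
  next
    case 2
    then show ?thesis by (intro red_Jdl Jdl_lmult Jdl_rmult) (simp add: pij_same)
  next
    case 3
    have "wrd [h k] * (pij s i j * wrd w) = wrd [h k] * ((pij s i j - - pij s j i) * wrd w)
        + - (wrd [h k] * (pij s j i * wrd w))"
      by (simp add: algebra_simps)
    also have "\<dots> \<in> red (Suc (length w + 2)) (Kgen s (h k) * Kw s w)"
      using 3 by (intro red_add red_uminus less red_Jdl Jdl_lmult Jdl_rmult pij_swap)
    finally show ?thesis .
  qed
qed

lemma red_lmult:
  assumes "a \<in> red n \<kappa>"
  shows "wrd [g] * a \<in> red (Suc n) (Kgen s g * \<kappa>)"
  using assms
proof induction
  case (red_Jdl a)
  then show ?case by (intro red.red_Jdl Jdl_lmult)
next
  case (red_pij w i j)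
  then show ?case
    using gen_pij_red[of Xg _ i j w] gen_pij_red[of Yg _ i j w] by (cases g) auto
next
  case (red_add a b)
  then show ?case by (simp add: distrib_left red.red_add)
next
  case (red_cst a c)
  then show ?case by (simp add: mult_cst_left[of "wrd [g]"] red.red_cst)
qed

text \<open>The definition of (ij) solved for x_i y_j. The kinds of the letters are swapped while
  the indices stay in place.\<close>

lemma xy_exchange:
  "wrd (Xg i # Yg j # w) = cst q * wrd (Yg i # Xg j # w) + cst s * (pij s i j * wrd w)"
proof -
  have "wrd (Xg i # Yg j # w) = xg i * (yg j * wrd w)"
    "wrd (Yg i # Xg j # w) = yg i * (xg j * wrd w)"
    by (simp_all add: xg_def yg_def wrd_mult)
  then show ?thesis by (simp add: pij_def cst_q algebra_simps)
qed

text \<open>Repeated exchange leaves the index sequence \<open>i # js\<close> unchanged, so the x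
  arrives at the end with the last index; hence \<open>butlast\<close> and
  \<open>last\<close>.\<close>

lemma x_past_ys:
  "wrd (Xg i # map Yg js @ v)
    - cst (q ^ length js) * wrd (map Yg (butlast (i # js)) @ Xg (last (i # js)) # v)
    \<in> red (Suc (length js + length v)) (inverse s * s ^ length js * Kw s v)"
proof (induction js arbitrary: i)
  case Nil
  show ?case by (simp add: red_0)
next
  case (Cons j js)
  let ?u = "wrd (Xg j # map Yg js @ v)"
    and ?u' = "wrd (map Yg (butlast (j # js)) @ Xg (last (j # js)) # v)"
  have "wrd (Xg i # map Yg (j # js) @ v)
      - cst (q ^ length (j # js)) * wrd (map Yg (butlast (i # j # js)) @ Xg (last (i # j # js)) # v)
    = cst q * (wrd [Yg i] * (?u - cst (q ^ length js) * ?u'))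
      + cst s * (pij s i j * wrd (map Yg js @ v))"
    by (simp add: xy_exchange right_diff_distrib mult_cst_left[of "wrd [Yg i]"] cst_mult_left wrd_mult)
  also have "\<dots> \<in> red (Suc (length (j # js) + length v)) (inverse s * s ^ length (j # js) * Kw s v)"
  proof (intro red_add red_cst)
    show "wrd [Yg i] * (?u - cst (q ^ length js) * ?u')
      \<in> red (Suc (length (j # js) + length v)) (inverse s * s ^ length (j # js) * Kw s v)"
      using red_lmult[OF Cons.IH, of "Yg i"] by (simp add: mult.assoc mult.left_commute)
    have "Kw s (map Yg js) = s ^ length js" by (induction js) simp_all
    then show "pij s i j * wrd (map Yg js @ v)
      \<in> red (Suc (length (j # js) + length v)) (inverse s * s ^ length (j # js) * Kw s v)"
      using s_nz by (intro red_pij) simp_all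
  qed
  finally show ?case .
qed

lemma Kw_ys: "Kw s (map Yg is) = s ^ length is" and Kw_xs: "Kw s (map Xg is) = inverse s ^ length is"
  by (induction "is") simp_all

text \<open>A y in front of a sorted word keeps it sorted, and an x in front is moved past the block
  of y by \<open>x_past_ys\<close>.\<close>

lemma word_reduce:
  "\<exists>c is js. length is + length js = length w \<and> Kw s (map Yg is @ map Xg js) = Kw s w \<and>
    wrd w - cst c * wrd (map Yg is @ map Xg js) \<in> red (length w) (Kw s w)"
proof (induction w)
  case Nil
  show ?case by (rule exI[of _ 1], rule exI[of _ "[]"], rule exI[of _ "[]"]) (simp add: red_0)
next
  case (Cons g w)
  then obtain c "is" js where len: "length is + length js = length w"
    and K: "Kw s (map Yg is @ map Xg js) = Kw s w"
    and r: "wrd w - cst c * wrd (map Yg is @ map Xg js) \<in> red (length w) (Kw s w)"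
    by blast
  let ?v = "map Yg is @ map Xg js"
  have r': "wrd (g # w) - cst c * wrd (g # ?v) \<in> red (length (g # w)) (Kw s (g # w))"
    using red_lmult[OF r, of g]
    by (simp add: right_diff_distrib mult_cst_left[of "wrd [g]"] wrd_mult)
  show ?case
  proof (cases g)
    case (Yg i)
    then show ?thesis using len K r'
      by (intro exI[of _ c] exI[of _ "i # is"] exI[of _ js]) simp
  next
    case (Xg i)
    let ?is = "butlast (i # is)" and ?js = "last (i # is) # js"
    have "wrd (g # ?v) - cst (q ^ length is) * wrd (map Yg ?is @ map Xg ?js)
        \<in> red (length (g # w)) (Kw s (g # w))"
      using x_past_ys[of i "is" "map Xg js"] len K Xg
      by (simp add: Kw_ys mult_ac)
    then have "(wrd (g # w) - cst c * wrd (g # ?v))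
      + cst c * (wrd (g # ?v) - cst (q ^ length is) * wrd (map Yg ?is @ map Xg ?js))
      \<in> red (length (g # w)) (Kw s (g # w))"
      by (intro red_add r' red_cst)
    moreover have "(wrd (g # w) - cst c * wrd (g # ?v))
      + cst c * (wrd (g # ?v) - cst (q ^ length is) * wrd (map Yg ?is @ map Xg ?js))
      = wrd (g # w) - cst (c * q ^ length is) * wrd (map Yg ?is @ map Xg ?js)"
      by (simp add: right_diff_distrib cst_mult_left)
    moreover have "length ?is + length ?js = length (g # w)"
      using len by auto
    moreover have "Kw s (map Yg ?is @ map Xg ?js) = Kw s (g # w)"
      using K Xg s_nz by (auto simp: Kw_ys Kw_xs)
    ultimately show ?thesis by metis
  qed
qed

lemma Fw_xs: "Fw s (map Xg js) = 0"
  by (induction js) simp_all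

text \<open>F turns each y in turn into an x, which is moved to the end of the block. A y with k
  further y after it contributes q^(2k), up to a common power of s. The weight has one y fewer and
  one x more; the \<open>+ 2\<close> avoids subtracting from \<open>length is\<close>.\<close>

lemma F_ys_xs:
  assumes "is \<noteq> []"
  shows "actF s (wrd (map Yg is @ map Xg js))
      - cst (inverse s ^ (length is + length js) * (\<Sum>k<length is. q ^ (2 * k)))
        * wrd (map Yg (butlast is) @ map Xg (last is # js))
    \<in> red (length is + length js) (s ^ length is * inverse s ^ (length js + 2))"
  using assms
proof (induction "is" rule: list_nonempty_induct)
  case (single i)
  show ?case
    by (simp add: act_simps Fw_xs Kw_xs xg_def wrd_mult cst_mult_left red_0 mult_ac)
next
  case (cons i "is")
  let ?n = "length is" and ?m = "length js" and ?v = "map Yg is @ map Xg js"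
    and ?u = "map Yg (butlast is) @ map Xg (last is # js)"
  let ?c = "inverse s ^ (?n + ?m) * (\<Sum>k<?n. q ^ (2 * k))"
    and ?\<kappa> = "s ^ length (i # is) * inverse s ^ (?m + 2)"
  have \<kappa>: "?\<kappa> = inverse s * s ^ ?n * inverse s ^ ?m"
    using s_nz by (simp add: field_simps)
  have r: "wrd [Yg i] * (actF s (wrd ?v) - cst ?c * wrd ?u) \<in> red (length (i # is) + ?m) ?\<kappa>"
    using red_lmult[OF cons.IH, of "Yg i"] by (simp add: mult.assoc)
  have x: "wrd (Xg i # ?v) - cst (q ^ ?n) * wrd (Yg i # ?u) \<in> red (length (i # is) + ?m) ?\<kappa>"
    using x_past_ys[of i "is" "map Xg js"] cons.hyps
    unfolding \<kappa> by (simp add: Kw_xs mult_ac)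
  have "s ^ ?n * s ^ ?n = q ^ ?n"
    by (metis power2_eq_square power_mult_distrib s_sq)
  then have sq: "inverse s ^ ?n * q ^ ?n = s ^ ?n"
    using s_nz by (simp add: field_simps)
  \<comment> \<open>The summand k = n belongs to the new y_i: K on the n later y gives s^n, which is
    \<open>inverse s ^ n * q ^ n\<close>, and moving the new x past them gives the other
    q^n.\<close>
  have "inverse s ^ (length (i # is) + ?m) * (\<Sum>k<length (i # is). q ^ (2 * k))
      = inverse s ^ ?m * inverse s * (inverse s ^ ?n * q ^ ?n) * q ^ ?n + inverse s * ?c"
    by (simp add: power_add mult_2 mult_2_right algebra_simps)
  then have C: "inverse s ^ (length (i # is) + ?m) * (\<Sum>k<length (i # is). q ^ (2 * k))
      = s ^ ?n * inverse s ^ ?m * inverse s * q ^ ?n + inverse s * ?c"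
    unfolding sq by (simp add: mult_ac)
  have "actF s (wrd (map Yg (i # is) @ map Xg js))
    = cst (s ^ ?n * inverse s ^ ?m * inverse s) * wrd (Xg i # ?v)
      + cst (inverse s) * (wrd [Yg i] * actF s (wrd ?v))"
    by (simp add: act_simps Kw_xs Kw_ys xg_def wrd_mult cst_mult_left mult.assoc)
  then have "actF s (wrd (map Yg (i # is) @ map Xg js))
      - cst (inverse s ^ (length (i # is) + ?m) * (\<Sum>k<length (i # is). q ^ (2 * k)))
        * wrd (map Yg (butlast (i # is)) @ map Xg (last (i # is) # js))
    = cst (s ^ ?n * inverse s ^ ?m * inverse s) * (wrd (Xg i # ?v) - cst (q ^ ?n) * wrd (Yg i # ?u))
      + cst (inverse s) * (wrd [Yg i] * (actF s (wrd ?v) - cst ?c * wrd ?u))"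
    unfolding C using cons.hyps
    by (simp add: right_diff_distrib distrib_right cst_add cst_mult_left
        mult_cst_left[of "wrd [Yg i]"] wrd_mult)
  also have "\<dots> \<in> red (length (i # is) + ?m) ?\<kappa>"
    by (intro red_add red_cst r x)
  finally show ?case .
qed

section \<open>Weight zero elements\<close>

abbreviation pij_alg :: "'i fa set" where
  "pij_alg \<equiv> subalg {pij s i j | i j. True}"

text \<open>The decomposition holds modulo the ideal, but the weight of c is exact, as
  \<open>kernel_EF\<close> requires.\<close>

definition decomp :: "'i::linorder fa set" where
  "decomp = {a. \<exists>b \<in> pij_alg. \<exists>c. actK s c = cst q * c \<and> a - (b + actF s c) \<in> Jdl q}"

lemma decompI:
  "b \<in> pij_alg \<Longrightarrow> actK s c = cst q * c \<Longrightarrow> a - (b + actF s c) \<in> Jdl q \<Longrightarrow> a \<in> decomp"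
  unfolding decomp_def by blast

lemma decompE:
  assumes "a \<in> decomp"
  obtains b c where "b \<in> pij_alg" "actK s c = cst q * c" "a - (b + actF s c) \<in> Jdl q"
  using assms unfolding decomp_def by blast

lemma pij_alg_0: "0 \<in> pij_alg"
  using subalg.intros(2)[of 0] by simp

lemma decomp_add:
  assumes "a \<in> decomp" "a' \<in> decomp"
  shows "a + a' \<in> decomp"
proof -
  obtain b c b' c' where "b \<in> pij_alg" "actK s c = cst q * c" "a - (b + actF s c) \<in> Jdl q"
    "b' \<in> pij_alg" "actK s c' = cst q * c'" "a' - (b' + actF s c') \<in> Jdl q"
    using assms by (elim decompE)
  moreover have "a + a' - (b + b' + actF s (c + c'))
      = (a - (b + actF s c)) + (a' - (b' + actF s c'))"
    by (simp add: act_simps)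
  ultimately show ?thesis
    by (intro decompI[of "b + b'" "c + c'"])
      (simp_all only: subalg.intros Jdl_add act_simps distrib_left)
qed

lemma decomp_pij_mult:
  assumes "a \<in> decomp"
  shows "pij s i j * a \<in> decomp"
proof -
  obtain b c where *: "b \<in> pij_alg" "actK s c = cst q * c" "a - (b + actF s c) \<in> Jdl q"
    using assms by (rule decompE)
  have "pij s i j * a - (pij s i j * b + actF s (pij s i j * c)) = pij s i j * (a - (b + actF s c))"
    by (simp add: actF_pij_mult algebra_simps)
  with * show ?thesis
    by (intro decompI[of "pij s i j * b" "pij s i j * c"])
      (auto intro!: Jdl_lmult subalg.intros(4) subalg.intros(1)[of "pij s i j"]
        simp: actK_pij_mult mult_cst_left[of "pij s i j"])
qed

lemma decomp_cst:
  assumes "a \<in> decomp"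
  shows "cst d * a \<in> decomp"
proof -
  obtain b c where *: "b \<in> pij_alg" "actK s c = cst q * c" "a - (b + actF s c) \<in> Jdl q"
    using assms by (rule decompE)
  have "cst d * a - (cst d * b + actF s (cst d * c)) = cst d * (a - (b + actF s c))"
    by (simp add: act_simps algebra_simps)
  with * show ?thesis
    by (intro decompI[of "cst d * b" "cst d * c"])
      (auto intro!: Jdl_lmult subalg.intros(4) subalg.intros(2)
        simp: act_simps cst_mult_left mult.commute)
qed

lemma decomp_Jdl: "a \<in> Jdl q \<Longrightarrow> a \<in> decomp"
  by (rule decompI[OF pij_alg_0, of 0]) (simp_all add: act_simps)

lemma decomp_actF: "actK s c = cst q * c \<Longrightarrow> actF s c \<in> decomp"
  by (rule decompI[OF pij_alg_0, of c]) (simp_all add: Jdl_zero)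

text \<open>As s^4 = q^2, s is not a root of unity either.\<close>

lemma power_s_inj: "s ^ m = s ^ n \<longleftrightarrow> m = n"
proof -
  have "m = n" if "s ^ m = s ^ n" "m \<le> n" for m n
  proof (rule ccontr)
    assume "m \<noteq> n"
    have "s ^ (n - m) = 1"
      using that s_nz by (simp add: power_diff)
    then have "(s ^ (n - m)) ^ 4 = 1" by simp
    moreover have "(s ^ (n - m)) ^ 4 = (s ^ 2) ^ (2 * (n - m))"
      by (simp only: power_mult[symmetric]) (simp add: mult.commute)
    ultimately show False
      using generic[of "n - m"] that \<open>m \<noteq> n\<close> s_sq by simp
  qed
  then show ?thesis by (metis nle_le)
qed

lemma sum_q_nz:
  assumes "n \<noteq> 0"
  shows "(\<Sum>k<n. q ^ (2 * k)) \<noteq> 0"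
proof -
  have "(\<Sum>k<n. (q\<^sup>2) ^ k) * (1 - q\<^sup>2) = 1 - (q\<^sup>2) ^ n"
    by (simp add: one_diff_power_eq mult.commute)
  moreover have "(q\<^sup>2) ^ n \<noteq> 1"
    using generic[of n] assms by (simp add: power_mult)
  ultimately show ?thesis by (auto simp: power_mult)
qed

lemma weight0_word_decomp:
  fixes w :: "'i::linorder gen list"
  shows "Kw s w = 1 \<Longrightarrow> wrd w \<in> decomp"
proof (induction "length w" arbitrary: w rule: less_induct)
  case less
  \<comment> \<open>The words behind (ij) are shorter by two and still of weight zero, so the
    induction hypothesis applies.\<close>
  have red: "a \<in> decomp" if "a \<in> red (length w) 1" for a :: "'i fa"
    using that
  proof induction
    case (red_pij v i j)
    then show ?case by (intro decomp_pij_mult less.hyps) auto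
  qed (auto intro: decomp_Jdl decomp_add decomp_cst)
  obtain c "is" js where len: "length is + length js = length w"
    and K: "Kw s (map Yg is @ map Xg js) = Kw s w"
    and r: "wrd w - cst c * wrd (map Yg is @ map Xg js) \<in> red (length w) (Kw s w)"
    using word_reduce by blast
  have "s ^ length is = s ^ length js"
    using K less.prems s_nz by (simp add: Kw_ys Kw_xs field_simps)
  then have eq: "length is = length js" by (simp add: power_s_inj)
  have "wrd (map Yg is @ map Xg js) \<in> decomp"
  proof (cases js)
    case Nil
    then have "cst 1 - (cst 1 + actF s 0) \<in> Jdl q" by (simp add: act_simps Jdl_zero)
    then have "cst 1 \<in> decomp" by (intro decompI[of "cst 1" 0] subalg.intros(2)) (simp_all add: act_simps)
    with Nil eq show ?thesis by (simp add: wrd_Nil)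
  next
    case (Cons j js')
    \<comment> \<open>The first x of \<open>?v\<close> is made the last y of \<open>?u\<close>, so
      that \<open>butlast\<close> and \<open>last\<close> in \<open>F_ys_xs\<close> give back
      exactly \<open>?v\<close>.\<close>
    let ?u = "wrd (map Yg (is @ [j]) @ map Xg js')" and ?v = "wrd (map Yg is @ map Xg js)"
      and ?C = "inverse s ^ length w * (\<Sum>k<length (is @ [j]). q ^ (2 * k))"
    have n: "length (is @ [j]) + length js' = length w"
      and wt: "s ^ length (is @ [j]) * inverse s ^ (length js' + 2) = 1"
      using Cons eq len s_nz by (simp_all add: field_simps)
    have "actF s ?u - cst ?C * ?v \<in> red (length w) 1"
      using F_ys_xs[of "is @ [j]" js'] Cons unfolding n wt by simp
    then have F: "actF s ?u - cst ?C * ?v \<in> decomp" by (rule red)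
    have "actK s ?u = cst q * ?u"
      using Cons eq s_nz
      by (simp add: act_simps Kw_ys Kw_xs field_simps s_sq[symmetric] power2_eq_square)
    then have "actF s ?u + cst (- 1) * (actF s ?u - cst ?C * ?v) \<in> decomp"
      by (intro decomp_add decomp_actF decomp_cst F)
    then have "cst ?C * ?v \<in> decomp" by (simp add: cst_uminus)
    then have "cst (inverse ?C) * (cst ?C * ?v) \<in> decomp" by (rule decomp_cst)
    moreover have "?C \<noteq> 0" using sum_q_nz[of "length (is @ [j])"] s_nz by simp
    then have "inverse ?C * ?C = 1" by (rule left_inverse)
    ultimately show ?thesis by (simp only: cst_mult_left cst_1 mult_1_left)
  qed
  then have "cst c * wrd (map Yg is @ map Xg js) \<in> decomp" by (rule decomp_cst)
  moreover have "wrd w - cst c * wrd (map Yg is @ map Xg js) \<in> decomp"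
    using r less.prems by (intro red) simp
  ultimately have "cst c * wrd (map Yg is @ map Xg js) + (wrd w - cst c * wrd (map Yg is @ map Xg js))
      \<in> decomp"
    by (rule decomp_add)
  then show ?case by simp
qed

section \<open>From words of weight zero to elements fixed by K modulo the ideal\<close>

definition wtpart :: "complex \<Rightarrow> 'i fa \<Rightarrow> 'i fa" where
  "wtpart \<mu> = linext (\<lambda>w. if Kw s w = \<mu> then wrd w else 0)"

lemmas wtpart_linear =
  linext_linear[of "\<lambda>w. if Kw s w = \<mu> then wrd w else 0" for \<mu>, folded wtpart_def]
  linext_wrd[of "\<lambda>w. if Kw s w = \<mu> then wrd w else 0" for \<mu>, folded wtpart_def]

lemma actK_wtpart: "actK s (wtpart \<mu> a) = cst \<mu> * wtpart \<mu> a"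
  by (induction a rule: fa_induct)
    (auto simp: act_simps wtpart_linear distrib_left cst_mult_left mult.commute)

lemma wtpart_1_decomp: "wtpart 1 a \<in> decomp"
  by (induction a rule: fa_induct)
    (auto simp: wtpart_linear intro: decomp_cst decomp_add weight0_word_decomp decomp_Jdl Jdl_zero)

text \<open>Allowing all finite supersets of M lets the weight sets of two summands be joined in the
  induction.\<close>

lemma sum_wtpart: "\<exists>M. finite M \<and> (\<forall>N. finite N \<longrightarrow> M \<subseteq> N \<longrightarrow> (\<Sum>\<mu>\<in>N. wtpart \<mu> a) = a)"
proof (induction a rule: fa_induct)
  case (word c w)
  have "(\<Sum>\<mu>\<in>N. wtpart \<mu> (cst c * wrd w)) = cst c * wrd w" if "finite N" "{Kw s w} \<subseteq> N" for N
  proof -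
    have "(\<Sum>\<mu>\<in>N. wtpart \<mu> (cst c * wrd w)) = (\<Sum>\<mu>\<in>N. if Kw s w = \<mu> then cst c * wrd w else 0)"
      by (rule sum.cong) (simp_all add: wtpart_linear)
    then show ?thesis using that by simp
  qed
  then show ?case by (intro exI[of _ "{Kw s w}"]) blast
next
  case (add a b)
  then obtain M M' where "finite M" "\<forall>N. finite N \<longrightarrow> M \<subseteq> N \<longrightarrow> (\<Sum>\<mu>\<in>N. wtpart \<mu> a) = a"
    "finite M'" "\<forall>N. finite N \<longrightarrow> M' \<subseteq> N \<longrightarrow> (\<Sum>\<mu>\<in>N. wtpart \<mu> b) = b" by blast
  then show ?case
    by (intro exI[of _ "M \<union> M'"]) (simp add: wtpart_linear sum.distrib)
qed

text \<open>Each step applies the polynomial \<open>(K - \<mu>) / (1 - \<mu>)\<close> in \<open>K\<close>, which removes the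
  weight \<open>\<mu>\<close> and is the identity on fixed points of \<open>K\<close>.\<close>
lemma weight_parts_Jdl:
  fixes a0 :: "'i::linorder fa"
  assumes "finite M" "1 \<notin> M" "actK s a0 = a0"
    and "\<And>\<mu>. \<mu> \<in> M \<Longrightarrow> actK s (f \<mu>) = cst \<mu> * f \<mu>"
    and "actK s (a0 + sum f M) - (a0 + sum f M) \<in> Jdl q"
  shows "sum f M \<in> Jdl q"
  using assms
proof (induction M arbitrary: f rule: finite_induct)
  case empty
  show ?case by (simp add: Jdl_zero)
next
  case (insert \<mu> M)
  let ?a = "a0 + sum f (insert \<mu> M)"
  let ?d = "inverse (1 - \<mu>)"
  let ?f = "\<lambda>\<nu>. cst (?d * (\<nu> - \<mu>)) * f \<nu>"
  have "\<mu> \<noteq> 1" using insert.prems by auto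
  have K_sum: "actK s (sum g N) = (\<Sum>\<nu>\<in>N. actK s (g \<nu>))" if "finite N" for g :: "complex \<Rightarrow> 'i fa" and N
    using that by induction (simp_all add: act_simps)
  have K: "actK s ?a = a0 + (\<Sum>\<nu>\<in>insert \<mu> M. cst \<nu> * f \<nu>)"
    using insert.hyps insert.prems by (simp add: act_simps K_sum)
  have "a0 + sum ?f M = cst ?d * (actK s ?a - cst \<mu> * ?a)"
  proof -
    have "cst ?d * (actK s ?a - cst \<mu> * ?a)
      = cst (?d * (1 - \<mu>)) * a0 + (\<Sum>\<nu>\<in>insert \<mu> M. ?f \<nu>)"
      unfolding K by (simp only: right_diff_distrib distrib_left sum_distrib_left cst_mult_left
          sum_subtractf cst_diff left_diff_distrib mult_1_right) (simp add: algebra_simps)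
    also have "\<dots> = a0 + sum ?f M"
      using insert.hyps \<open>\<mu> \<noteq> 1\<close> by simp
    finally show ?thesis ..
  qed
  also have "\<dots> = cst ?d * (actK s ?a - ?a) + cst (?d * (1 - \<mu>)) * ?a"
    by (simp add: cst_mult cst_diff algebra_simps mult_cst_left[of "cst \<mu>" ?d])
  finally have eq: "a0 + sum ?f M = cst ?d * (actK s ?a - ?a) + ?a"
    using \<open>\<mu> \<noteq> 1\<close> by simp
  \<comment> \<open>The change of \<open>?a\<close> under the polynomial in K; it lies in the ideal
    because K fixes \<open>?a\<close> modulo the ideal.\<close>
  define e where "e = cst ?d * (actK s ?a - ?a)"
  have e: "e \<in> Jdl q" unfolding e_def by (intro Jdl_lmult insert.prems)
  have "sum ?f M \<in> Jdl q"
  proof (rule insert.IH)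
    show "actK s (?f \<nu>) = cst \<nu> * ?f \<nu>" if "\<nu> \<in> M" for \<nu>
      using insert.prems(3)[of \<nu>] that by (simp add: act_simps cst_mult_left mult.commute)
    have "actK s (a0 + sum ?f M) - (a0 + sum ?f M) = actK s e - e + (actK s ?a - ?a)"
      unfolding eq e_def[symmetric] by (simp add: act_simps)
    also have "\<dots> \<in> Jdl q"
      by (intro Jdl_add Jdl_diff act_Jdl e insert.prems)
    finally show "actK s (a0 + sum ?f M) - (a0 + sum ?f M) \<in> Jdl q" .
  qed (use insert.prems in auto)
  moreover have "sum f (insert \<mu> M) = sum ?f M - e"
    using eq unfolding e_def[symmetric] by (simp add: algebra_simps)
  ultimately show ?case using e by (simp add: Jdl_diff)
qed

text \<open>K fixes a only modulo the ideal, so a may contain words of other weights; their total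
  lies in the ideal.\<close>

lemma weight0_decomp:
  assumes "actK s a - a \<in> Jdl q"
  shows "a \<in> decomp"
proof -
  obtain M where M: "finite M" "\<And>N. finite N \<Longrightarrow> M \<subseteq> N \<Longrightarrow> (\<Sum>\<mu>\<in>N. wtpart \<mu> a) = a"
    using sum_wtpart by blast
  \<comment> \<open>The weight 1 need not occur in \<open>M\<close>, hence the passage to
    \<open>insert 1 M\<close>.\<close>
  have a: "a = wtpart 1 a + (\<Sum>\<mu>\<in>M - {1}. wtpart \<mu> a)"
    using M(1) M(2)[of "insert 1 M"] by (simp add: sum.insert_remove subset_insertI)
  have "(\<Sum>\<mu>\<in>M - {1}. wtpart \<mu> a) \<in> Jdl q"
    using assms M(1) a[symmetric]
    by (intro weight_parts_Jdl[of _ "wtpart 1 a"]) (simp_all add: actK_wtpart)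
  then show ?thesis
    by (subst a) (intro decomp_add decomp_Jdl wtpart_1_decomp)
qed

section \<open>The kernel of $EF$\<close>

lemma actK_wrd: "actK s (wrd w) = cst (Kw s w) * wrd w"
  by (simp add: act_simps)

lemma actKinv_actK: "actKinv s (actK s a) = a"
proof (induction a rule: fa_induct)
  case (word c w)
  have "Kw s w \<noteq> 0"
  proof (induction w)
    case (Cons g w)
    then show ?case using s_nz by (cases g) simp_all
  qed simp
  then show ?case by (simp add: act_simps cst_mult_left Kinvw_eq mult.assoc)
qed (simp add: act_simps)

text \<open>E replaces a letter of eigenvalue 1/s by one of eigenvalue s, a factor s^2 = q.\<close>

lemma actK_actE: "actK s (actE s a) = cst q * actE s (actK s a)"
proof (induction a rule: fa_induct)
  case (word c w)
  have "actK s (actE s (wrd w)) = cst (q * Kw s w) * actE s (wrd w)"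
  proof (induction w)
    case Nil
    show ?case by (simp add: wrd_Nil act_simps)
  next
    case (Cons g w)
    let ?\<kappa> = "Kw s w" and ?w = "wrd w"
    show ?case
    proof (cases g)
      case (Xg i)
      have "wrd (g # w) = xg i * ?w" by (simp add: Xg wrd_gen)
      then show ?thesis using Cons s_nz
        by (simp add: Xg act_mult act_linear actK_wrd mult_cst_left[of "xg _"] mult_cst_left[of "yg _"]
            cst_mult_left distrib_left mult.assoc s_sq[symmetric] power2_eq_square mult_ac s_inverse)
    next
      case (Yg i)
      have "wrd (g # w) = yg i * ?w" by (simp add: Yg wrd_gen)
      then show ?thesis using Cons s_nz
        by (simp add: Yg act_mult act_linear actK_wrd mult_cst_left[of "xg _"] mult_cst_left[of "yg _"]
            cst_mult_left distrib_left mult.assoc s_sq[symmetric] power2_eq_square mult_ac s_inverse)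
    qed
  qed
  then show ?case by (simp add: act_simps cst_mult_left mult_ac)
qed (simp add: act_simps distrib_left)

lemma actK_actF: "actK s (actF s a) = cst (inverse q) * actF s (actK s a)"
proof (induction a rule: fa_induct)
  case (word c w)
  have "actK s (actF s (wrd w)) = cst (inverse q * Kw s w) * actF s (wrd w)"
  proof (induction w)
    case Nil
    show ?case by (simp add: wrd_Nil act_simps)
  next
    case (Cons g w)
    let ?\<kappa> = "Kw s w" and ?w = "wrd w"
    show ?case
    proof (cases g)
      case (Xg i)
      have "wrd (g # w) = xg i * ?w" by (simp add: Xg wrd_gen)
      then show ?thesis using Cons s_nz
        by (simp add: Xg act_mult act_linear actK_wrd mult_cst_left[of "xg _"] mult_cst_left[of "yg _"]
            cst_mult_left distrib_left mult.assoc s_sq[symmetric] power2_eq_square mult_ac s_inverse)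
    next
      case (Yg i)
      have "wrd (g # w) = yg i * ?w" by (simp add: Yg wrd_gen)
      then show ?thesis using Cons s_nz
        by (simp add: Yg act_mult act_linear actK_wrd mult_cst_left[of "xg _"] mult_cst_left[of "yg _"]
            cst_mult_left distrib_left mult.assoc s_sq[symmetric] power2_eq_square mult_ac s_inverse)
    qed
  qed
  then show ?case by (simp add: act_simps cst_mult_left mult_ac)
qed (simp add: act_simps distrib_left)

text \<open>For D = EF - FE the cross terms cancel, so D(ab) = D(a) K^2(b) + K^-2(a) D(b). With D
  x_i = - x_i and D y_i = y_i this gives an induction on the first letter; the denominator is
  cleared.\<close>

lemma E_F_commutator:
  "cst (q - inverse q) * (actE s (actF s a) - actF s (actE s a))
    = actK s (actK s a) - actKinv s (actKinv s a)"
proof (induction a rule: fa_induct)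
  case (word c w)
  let ?D = "\<lambda>a. actE s (actF s a) - actF s (actE s a)" and ?\<delta> = "q - inverse q"
  have "cst ?\<delta> * ?D (wrd w) = cst (Kw s w * Kw s w - Kinvw s w * Kinvw s w) * wrd w"
  proof (induction w)
    case Nil
    show ?case by (simp add: act_simps wrd_Nil)
  next
    case (Cons g w)
    let ?\<kappa> = "Kw s w" and ?\<kappa>' = "Kinvw s w" and ?w = "wrd w"
    show ?case
    proof (cases g)
      case (Xg i)
      have w: "wrd (g # w) = xg i * ?w" by (simp add: Xg wrd_gen)
      have "?D (xg i * ?w) = cst q * (xg i * ?D ?w) + cst (- (?\<kappa> * ?\<kappa>)) * (xg i * ?w)"
        using s_nz
        by (simp add: act_mult act_linear actK_wrd actK_actF mult_cst_left[of "xg _"] mult_cst_left[of "yg _"]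
            cst_mult_left distrib_left right_diff_distrib cst_uminus s_sq[symmetric] power2_eq_square mult_ac s_inverse)
      then have "cst ?\<delta> * ?D (xg i * ?w)
          = cst q * (xg i * (cst ?\<delta> * ?D ?w)) + cst (- (?\<delta> * (?\<kappa> * ?\<kappa>))) * (xg i * ?w)"
        by (simp only: distrib_left mult_cst_left[of "xg _"] cst_mult_left mult.commute[of ?\<delta> q]
            mult_minus_right)
      also have "\<dots> = cst (q * (?\<kappa> * ?\<kappa> - ?\<kappa>' * ?\<kappa>') - ?\<delta> * (?\<kappa> * ?\<kappa>)) * (xg i * ?w)"
        unfolding Cons
        by (simp only: mult_cst_left[of "xg _"] cst_mult_left distrib_right[symmetric] cst_add[symmetric]
            add_uminus_conv_diff)
      also have "q * (?\<kappa> * ?\<kappa> - ?\<kappa>' * ?\<kappa>') - ?\<delta> * (?\<kappa> * ?\<kappa>)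
          = Kw s (g # w) * Kw s (g # w) - Kinvw s (g # w) * Kinvw s (g # w)"
        by (simp add: Xg s_sq[symmetric] power2_eq_square algebra_simps)
      finally show ?thesis unfolding w .
    next
      case (Yg i)
      have w: "wrd (g # w) = yg i * ?w" by (simp add: Yg wrd_gen)
      have "?D (yg i * ?w) = cst (inverse q) * (yg i * ?D ?w) + cst (?\<kappa> * ?\<kappa>) * (yg i * ?w)"
        using s_nz
        by (simp add: act_mult act_linear actK_wrd actK_actE mult_cst_left[of "xg _"] mult_cst_left[of "yg _"]
            cst_mult_left distrib_left right_diff_distrib s_sq[symmetric] power2_eq_square mult_ac s_inverse)
      then have "cst ?\<delta> * ?D (yg i * ?w)
          = cst (inverse q) * (yg i * (cst ?\<delta> * ?D ?w)) + cst (?\<delta> * (?\<kappa> * ?\<kappa>)) * (yg i * ?w)"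
        by (simp only: distrib_left mult_cst_left[of "yg _"] cst_mult_left mult.commute[of ?\<delta> "inverse q"])
      also have "\<dots> = cst (inverse q * (?\<kappa> * ?\<kappa> - ?\<kappa>' * ?\<kappa>') + ?\<delta> * (?\<kappa> * ?\<kappa>)) * (yg i * ?w)"
        unfolding Cons
        by (simp only: mult_cst_left[of "yg _"] cst_mult_left distrib_right[symmetric] cst_add[symmetric])
      also have "inverse q * (?\<kappa> * ?\<kappa> - ?\<kappa>' * ?\<kappa>') + ?\<delta> * (?\<kappa> * ?\<kappa>)
          = Kw s (g # w) * Kw s (g # w) - Kinvw s (g # w) * Kinvw s (g # w)"
        by (simp add: Yg s_sq[symmetric] power2_eq_square algebra_simps)
      finally show ?thesis unfolding w .
    qed
  qed
  then have "cst c * (cst ?\<delta> * ?D (wrd w))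
      = cst c * (cst (Kw s w * Kw s w - Kinvw s w * Kinvw s w) * wrd w)"
    by (rule arg_cong)
  then show ?case
    by (simp add: act_simps cst_mult_left right_diff_distrib left_diff_distrib cst_diff mult_ac)
next
  case (add a b)
  have "cst (q - inverse q) * (actE s (actF s (a + b)) - actF s (actE s (a + b)))
    = cst (q - inverse q) * (actE s (actF s a) - actF s (actE s a))
      + cst (q - inverse q) * (actE s (actF s b) - actF s (actE s b))"
    by (simp add: act_simps algebra_simps)
  then show ?case unfolding add by (simp add: act_simps)
qed

text \<open>\<open>E\<close> turns letters \<open>x\<close> into letters \<open>y\<close>.\<close>
lemma actE_nilpotent: "\<exists>n. (actE s ^^ n) a = 0"
proof (induction a rule: fa_induct)
  case (word c w)
  have pow_cst: "(actE s ^^ n) (cst c * a) = cst c * (actE s ^^ n) a" for n c a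
    by (induction n) (simp_all add: act_simps)
  have "\<exists>n. (actE s ^^ n) (wrd w) = 0"
  proof (induction w)
    case Nil
    show ?case by (rule exI[of _ 1]) (simp add: wrd_Nil)
  next
    case (Cons g w)
    then obtain n where n: "(actE s ^^ n) (wrd w) = 0" by blast
    have K: "actK s ((actE s ^^ n) (wrd w)) = cst (q ^ n * Kw s w) * (actE s ^^ n) (wrd w)" for n
      by (induction n) (simp_all add: actK_wrd actK_actE act_linear cst_mult_left mult.assoc)
    show ?case
    proof (cases g)
      case (Yg i)
      have "(actE s ^^ n) (wrd (g # w)) = cst (inverse s ^ n) * (yg i * (actE s ^^ n) (wrd w))" for n
        by (induction n) (simp_all add: wrd_gen Yg act_mult act_linear mult_cst_left[of "yg i"] cst_mult_left mult.assoc mult.commute)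
      then show ?thesis using n by (intro exI[of _ n]) simp
    next
      case (Xg i)
      \<comment> \<open>The scalar \<alpha> can stay unspecified: both terms vanish once the power
        of E in the first one annihilates w.\<close>
      have "\<exists>\<alpha>. (actE s ^^ Suc n) (wrd (g # w))
        = cst \<alpha> * (yg i * (actE s ^^ n) (wrd w)) + cst (s ^ Suc n) * (xg i * (actE s ^^ Suc n) (wrd w))" for n
      proof (induction n)
        case 0
        show ?case
          by (rule exI[of _ "s * Kw s w"])
            (simp add: wrd_gen Xg act_mult act_linear actK_wrd cst_mult mult.assoc mult_cst_left[of "yg _" "Kw s w"])
      next
        case (Suc n)
        then obtain \<alpha> where \<alpha>: "(actE s ^^ Suc n) (wrd (g # w))
          = cst \<alpha> * (yg i * (actE s ^^ n) (wrd w)) + cst (s ^ Suc n) * (xg i * (actE s ^^ Suc n) (wrd w))"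
          by blast
        let ?a = "(actE s ^^ n) (wrd w)"
        have "(actE s ^^ Suc (Suc n)) (wrd (g # w)) = actE s ((actE s ^^ Suc n) (wrd (g # w)))"
          by simp
        also have "\<dots> = cst (\<alpha> * inverse s + s ^ Suc n * s * (q ^ Suc n * Kw s w)) * (yg i * (actE s ^^ Suc n) (wrd w))
            + cst (s ^ Suc (Suc n)) * (xg i * (actE s ^^ Suc (Suc n)) (wrd w))"
          unfolding \<alpha> using K[of "Suc n"]
          by (simp add: act_mult act_linear cst_add distrib_right distrib_left mult.assoc
              mult_cst_left[of "yg _"] cst_mult_left mult_ac)
        finally show ?case by blast
      qed
      then obtain \<alpha> where "(actE s ^^ Suc (Suc n)) (wrd (g # w))
        = cst \<alpha> * (yg i * (actE s ^^ Suc n) (wrd w))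
          + cst (s ^ Suc (Suc n)) * (xg i * (actE s ^^ Suc (Suc n)) (wrd w))"
        by blast
      moreover have "(actE s ^^ Suc n) (wrd w) = 0" "(actE s ^^ Suc (Suc n)) (wrd w) = 0"
        using n by (simp_all add: act_linear)
      ultimately have "(actE s ^^ Suc (Suc n)) (wrd (g # w)) = 0"
        by (simp only: mult_zero_right add_0)
      then show ?thesis by blast
    qed
  qed
  then show ?case by (metis pow_cst mult_zero_right)
next
  case (add a b)
  then obtain m n where *: "(actE s ^^ m) a = 0" "(actE s ^^ n) b = 0" by blast
  have E0: "(actE s ^^ n) 0 = 0" for n
    by (induction n) (simp_all add: act_simps)
  have pow_add: "(actE s ^^ n) (a + b) = (actE s ^^ n) a + (actE s ^^ n) b" for n a b
    by (induction n) (simp_all add: act_simps)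
  have "(actE s ^^ (m + n)) (a + b) = (actE s ^^ n) ((actE s ^^ m) a) + (actE s ^^ m) ((actE s ^^ n) b)"
    unfolding pow_add by (metis add.commute comp_apply funpow_add)
  then show ?case by (auto simp: * E0)
qed

text \<open>Multiplication by q^n gives q^(2n) - 1.\<close>

lemma q_power_diff_nz:
  assumes "n \<ge> 1"
  shows "q ^ n - inverse q ^ n \<noteq> 0"
proof
  assume "q ^ n - inverse q ^ n = 0"
  then have "q ^ n * q ^ n = 1"
    using q_nz by (simp add: field_simps)
  then show False
    using generic[OF assms] by (simp add: mult_2 power_add)
qed

text \<open>The scalar in the claim below is \<open>(q - 1/q)^2 [k+1] [k+2]\<close>, accumulated by moving \<open>F\<close> to the
  left through \<open>E\<close>; as \<open>E\<close> is nilpotent, the claims then descend from large \<open>k\<close> to \<open>c\<close> itself.\<close>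
lemma kernel_EF:
  assumes K: "actK s c = cst q * c" and EF: "actE s (actF s c) \<in> Jdl q"
  shows "c \<in> Jdl q"
proof -
  define e where "e k = (actE s ^^ k) c" for k
  define \<delta> where "\<delta> = q - inverse q"
  define G where "G k = (q ^ (k + 1) - inverse q ^ (k + 1)) * (q ^ (k + 2) - inverse q ^ (k + 2))" for k
  have e_Suc: "\<And>k. e (Suc k) = actE s (e k)" and e_0: "e 0 = c"
    by (simp_all add: e_def)
  have K_e: "actK s (e k) = cst (q ^ (k + 1)) * e k" for k
  proof (induction k)
    case 0
    show ?case by (simp add: K e_0)
  next
    case (Suc k)
    then show ?case by (simp add: e_Suc actK_actE act_simps cst_mult_left)
  qed
  have Kinv_e: "actKinv s (e k) = cst (inverse q ^ (k + 1)) * e k" for k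
  proof -
    have "cst (inverse q ^ (k + 1)) * actKinv s (actK s (e k)) = actKinv s (e k)"
      unfolding K_e using q_nz by (simp add: act_simps cst_mult_left power_inverse del: power_Suc)
    then show ?thesis by (simp add: actKinv_actK)
  qed
  have comm: "cst \<delta> * actE s (actF s (e k))
      = cst \<delta> * actF s (e (Suc k)) + cst (q ^ (2 * k + 2) - inverse q ^ (2 * k + 2)) * e k" for k
  proof -
    have "q ^ (2 * k + 2) = q ^ (k + 1) * q ^ (k + 1)"
      "inverse q ^ (2 * k + 2) = inverse q ^ (k + 1) * inverse q ^ (k + 1)"
      by (simp_all add: mult_2 power_add)
    then show ?thesis
      using E_F_commutator[of "e k"] unfolding \<delta>_def e_Suc
      by (simp add: K_e Kinv_e act_simps cst_mult_left cst_diff algebra_simps del: power_Suc)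
  qed
  have claim: "cst (\<delta> * \<delta>) * actF s (e (Suc k)) + cst (G k) * e k \<in> Jdl q" for k
  proof (induction k)
    case 0
    have "cst (\<delta> * \<delta>) * actF s (e 1) + cst (G 0) * e 0 = cst \<delta> * (cst \<delta> * actE s (actF s c))"
      unfolding e_0[symmetric] comm
      by (simp add: G_def \<delta>_def distrib_left cst_mult_left mult.assoc)
    also have "\<dots> \<in> Jdl q" by (intro Jdl_lmult EF)
    finally show ?case by simp
  next
    case (Suc k)
    have "q * inverse q = 1" using q_nz by simp
    \<comment> \<open>\<open>G k\<close> expands to q^(2k+3) + q^-(2k+3) - q - 1/q, so the product
      with \<delta> is the difference of consecutive values.\<close>
    then have "G (Suc k) = \<delta> * (q ^ (2 * Suc k + 2) - inverse q ^ (2 * Suc k + 2)) + G k"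
      unfolding G_def \<delta>_def using q_nz
      by (simp add: field_simps power_add power_mult power2_eq_square)
    then have "cst (\<delta> * \<delta>) * actF s (e (Suc (Suc k))) + cst (G (Suc k)) * e (Suc k)
      = cst \<delta> * (cst \<delta> * actE s (actF s (e (Suc k)))) + cst (G k) * actE s (e k)"
      unfolding comm by (simp add: e_Suc cst_add cst_mult_left distrib_left distrib_right)
    also have "\<dots> = actE s (cst (\<delta> * \<delta>) * actF s (e (Suc k)) + cst (G k) * e k)"
      by (simp add: act_simps cst_mult_left)
    also have "\<dots> \<in> Jdl q" by (intro act_Jdl Suc.IH)
    finally show ?case .
  qed
  have G_nz: "G k \<noteq> 0" for k
    using q_power_diff_nz[of "k + 1"] q_power_diff_nz[of "k + 2"] by (simp add: G_def)
  \<comment> \<open>If \<open>e (Suc k)\<close> lies in the ideal, so does its image under F, and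
    the claim leaves a nonzero multiple of \<open>e k\<close>.\<close>
  have down: "e k \<in> Jdl q" if "e (Suc k) \<in> Jdl q" for k
  proof -
    have "cst (inverse (G k)) * ((cst (\<delta> * \<delta>) * actF s (e (Suc k)) + cst (G k) * e k)
        - cst (\<delta> * \<delta>) * actF s (e (Suc k))) \<in> Jdl q"
      by (intro Jdl_lmult Jdl_diff claim act_Jdl that)
    then show ?thesis using G_nz[of k] by (simp add: cst_mult_left)
  qed
  obtain n where "(actE s ^^ n) c = 0"
    using actE_nilpotent by blast
  then have "e n \<in> Jdl q" by (simp add: e_def Jdl_zero)
  then have "e 0 \<in> Jdl q"
    by (induction n) (auto intro: down)
  then show ?thesis by (simp add: e_0)
qed

section \<open>Invariant elements\<close>

lemma pij_invariant: "pij s i j \<in> invariants q s"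
proof -
  have "s powi 2 = q" using s_sq by simp
  then have "invariant_deg q s 2 (pij s i j)"
    by (simp add: invariant_deg_def Jdl_zero)
  then show ?thesis unfolding invariants_def by blast
qed

lemma actE_pij_alg:
  assumes "b \<in> pij_alg"
  shows "actE s b = 0"
proof -
  \<comment> \<open>The Leibniz rule for a product involves K and its inverse, so their values are
    carried through the induction.\<close>
  have "actE s b = 0 \<and> actK s b = b \<and> actKinv s b = b"
    using assms by induction (auto simp: act_linear act_mult)
  then show ?thesis by blast
qed

lemma invariant_in_pij_alg:
  assumes "a \<in> invariants q s"
  shows "\<exists>b \<in> pij_alg. a - b \<in> Jdl q"
proof -
  have E: "actE s a \<in> Jdl q" and K: "actK s a - a \<in> Jdl q"
    using assms by (auto simp: invariants_def invariant_deg_def)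
  obtain b c where b: "b \<in> pij_alg" and c: "actK s c = cst q * c"
    and abc: "a - (b + actF s c) \<in> Jdl q"
    using weight0_decomp[OF K] by (rule decompE)
  \<comment> \<open>E annihilates b, so applying E to the decomposition of a leaves only E F
    c.\<close>
  have "actE s a - actE s (a - (b + actF s c)) \<in> Jdl q"
    by (intro Jdl_diff E act_Jdl abc)
  then have "actE s (actF s c) \<in> Jdl q"
    by (simp add: act_linear actE_pij_alg[OF b])
  then have "c \<in> Jdl q" by (rule kernel_EF[OF c])
  then have "(a - (b + actF s c)) + actF s c \<in> Jdl q"
    by (intro Jdl_add abc act_Jdl)
  with b show ?thesis by auto
qed

text \<open>Congruence modulo a two-sided ideal respects sums and products, so it passes from
  invariants to the algebra they generate.\<close>

lemma subalg_invariants: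
  assumes "a \<in> subalg (invariants q s)"
  shows "\<exists>b \<in> pij_alg. a - b \<in> Jdl q"
  using assms
proof induction
  case (1 a)
  then show ?case by (rule invariant_in_pij_alg)
next
  case (2 c)
  show ?case by (rule bexI[of _ "cst c"]) (simp_all add: Jdl_zero subalg.intros(2))
next
  case (3 a a')
  then obtain b b' where b: "b \<in> pij_alg" "b' \<in> pij_alg" and J: "a - b \<in> Jdl q" "a' - b' \<in> Jdl q"
    by blast
  have "a + a' - (b + b') = (a - b) + (a' - b')" by simp
  also have "\<dots> \<in> Jdl q" by (intro Jdl_add J)
  finally show ?case using subalg.intros(3)[OF b] by blast
next
  case (4 a a')
  then obtain b b' where b: "b \<in> pij_alg" "b' \<in> pij_alg" and J: "a - b \<in> Jdl q" "a' - b' \<in> Jdl q"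
    by blast
  have "a * a' - b * b' = (a - b) * a' + b * (a' - b')" by (simp add: algebra_simps)
  also have "\<dots> \<in> Jdl q" by (intro Jdl_add Jdl_lmult Jdl_rmult J)
  finally show ?case using subalg.intros(4)[OF b] by blast
qed

end

theorem theorem3p6:
  fixes q s :: complex
  assumes "cmod q = 1"
    and "q \<noteq> 1" and "q \<noteq> -1" and "q \<noteq> \<i>" and "q \<noteq> - \<i>"
    and "s ^ 2 = q"
    and "\<forall>d::nat. d \<ge> 1 \<longrightarrow> q ^ (2 * d) \<noteq> 1"
  shows "(\<forall>a \<in> subalg (invariants q s :: ('i::linorder) fa set).
            \<exists>b \<in> subalg {pij s i j | i j. True}. a - b \<in> Jdl q)
       \<and> (\<forall>b \<in> subalg {pij s i j | i j. True :: bool}.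
            \<exists>a \<in> subalg (invariants q s :: ('i::linorder) fa set). a - b \<in> Jdl q)"
proof -
  interpret quantum_plane q s
    using assms by unfold_locales auto
  \<comment> \<open>Each (ij) is itself invariant, so this inclusion holds in the free algebra and b
    represents itself.\<close>
  have "b \<in> subalg (invariants q s)" if "b \<in> pij_alg" for b :: "'i fa"
    using that by induction (auto intro: subalg.intros pij_invariant)
  moreover have "b - b \<in> Jdl q" for b :: "'i fa"
    by (simp add: Jdl_zero)
  ultimately show ?thesis
    using subalg_invariants by blast
qed

end
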